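(* Let $A,B,C$ be associative, commutative $\mathbb{C}$-algebras. If $f:A\to B$ and $g:B\to C$ are Frobenius $n$- and $m$-homomorphisms, respectively, then $gf:A\to C$ is a Frobenius $mn$-homomorphism.
   Context: Algebras are unital. For a linear map $f:A\to B$ between commutative associative $\mathbb{C}$-algebras and $n\ge1$, define $\Phi_n(f):A^{\otimes n}\to B$ by $\Phi_n(f)(a_1,\dots,a_n)=\sum_{\sigma\in\Sigma_n}\varepsilon_\sigma f_{\gamma_1}(a_1,\dots,a_n)\cdots f_{\gamma_r}(a_1,\dots,a_n)$, where $\sigma=\gamma_1\cdots\gamma_r$ is the decomposition into disjoint cycles of total length $n$ (cycles of length 1 included), $\varepsilon_\sigma$ is the sign of $\sigma$, and $f_\gamma(a_1,\dots,a_n)=f(a_{i_1}a_{i_2}\cdots a_{i_m})$ for a cycle $\gamma=(i_1\dots i_m)$. A linear map $f:A\to B$ is a Frobenius $n$-homomorphism if $f(1)=n$ and $\Phi_{n+1}(f)\equiv0$. *)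

theory Defs
  imports Complex_Main "HOL-Combinatorics.Combinatorics"
begin

text \<open>
  Algebras carry an explicit scalar multiplication. The sort is
  comm_ring together with comm_monoid_mult rather than comm_ring_1, because the latter
  requires 0 \<noteq> 1 and would exclude the zero algebra.
\<close>

locale comm_complex_algebra = vector_space scale
  for scale :: "complex \<Rightarrow> 'a::{comm_ring,comm_monoid_mult} \<Rightarrow> 'a" +
  assumes scale_mult_left: "scale c (x * y) = scale c x * y"

text \<open>
  The cycles of \<sigma> are represented by their supports, which are the orbits of \<sigma>;
  a fixed point i gives the cycle {i}. Since the algebra is commutative, the product of the
  a i along a cycle depends only on its support. The image below is a set of pairwise disjoint
  orbits, so each cycle contributes exactly one factor.
\<close>

definition perm_cycles :: "nat \<Rightarrow> (nat \<Rightarrow> nat) \<Rightarrow> nat set set" where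
  "perm_cycles n \<sigma> = orbit \<sigma> ` {1..n}"

definition cycle_val ::
  "('a::comm_monoid_mult \<Rightarrow> 'b) \<Rightarrow> nat set \<Rightarrow> (nat \<Rightarrow> 'a) \<Rightarrow> 'b" where
  "cycle_val f \<gamma> a = f (\<Prod>i\<in>\<gamma>. a i)"

text \<open>
  The argument a encodes the tuple a 1, ..., a n; its values outside {1..n} are irrelevant.
  As a multilinear map, Phi is given by its values on pure tensors.
\<close>

definition Phi ::
  "(complex \<Rightarrow> 'b \<Rightarrow> 'b) \<Rightarrow> nat \<Rightarrow> ('a::{comm_ring,comm_monoid_mult} \<Rightarrow> 'b::{comm_ring,comm_monoid_mult})
     \<Rightarrow> (nat \<Rightarrow> 'a) \<Rightarrow> 'b" where
  "Phi sB n f a =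
     (\<Sum>\<sigma> | \<sigma> permutes {1..n}.
        sB (of_int (sign \<sigma>)) (\<Prod>\<gamma>\<in>perm_cycles n \<sigma>. cycle_val f \<gamma> a))"

text \<open>The equation f 1 = n in the codomain B is read as f 1 = n times the unit of B.
  The case n = 0, where f = Phi 1 f vanishes, is not excluded.\<close>

definition frobenius_hom ::
  "(complex \<Rightarrow> 'a \<Rightarrow> 'a) \<Rightarrow> (complex \<Rightarrow> 'b \<Rightarrow> 'b) \<Rightarrow> nat
     \<Rightarrow> ('a::{comm_ring,comm_monoid_mult} \<Rightarrow> 'b::{comm_ring,comm_monoid_mult}) \<Rightarrow> bool" where
  "frobenius_hom sA sB n f \<longleftrightarrow>
     Vector_Spaces.linear sA sB f \<and>
     f 1 = sB (of_nat n) 1 \<and>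
     (\<forall>a. Phi sB (n + 1) f a = 0)"

end

theory Submission
  imports Defs
begin

text \<open>
  Expanding over the cycle that contains the first index gives the recursion
  \<open>\<Phi>(a\<^sub>0, a\<^sub>1, \<dots>, a\<^sub>k) = f a\<^sub>0 * \<Phi>(a\<^sub>1, \<dots>, a\<^sub>k) - (\<Sum>i. \<Phi>(a\<^sub>1, \<dots>, a\<^sub>0 * a\<^sub>i, \<dots>, a\<^sub>k))\<close>,
  so \<open>\<Phi>\<close> vanishes in all arities above \<open>n\<close> once it vanishes in arity \<open>n + 1\<close>.
  By induction, the recursion also yields a polarised form of
  \<open>exp (g (log (exp (f (log (1 + a))))))\<close>: the form of \<open>g \<circ> f\<close> is the sum, over the set partitions
  of the index set, of the form of \<open>g\<close> applied to the tuple of the forms of \<open>f\<close> on the blocks.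
  A partition of \<open>m * n + 1\<close> indices either has more than \<open>m\<close> blocks, so that the form of \<open>g\<close>
  vanishes, or has a block with more than \<open>n\<close> elements, so that the form of \<open>g\<close> has a zero argument.
\<close>

section \<open>The recursive form: reindexing, additivity, vanishing\<close>

text \<open>The index type is left arbitrary because the form of \<open>g\<close> is later indexed
  by the blocks of a partition, which are themselves lists.\<close>

fun frob_form :: "('a::{comm_ring,comm_monoid_mult} \<Rightarrow> 'b::{comm_ring,comm_monoid_mult})
    \<Rightarrow> ('i \<Rightarrow> 'a) \<Rightarrow> 'i list \<Rightarrow> 'b" where
  "frob_form f a [] = 1"
| "frob_form f a (k # ks) =
     f (a k) * frob_form f a ks - (\<Sum>i\<in>set ks. frob_form f (a(i := a k * a i)) ks)"

lemma frob_form_cong: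
  "(\<And>i. i \<in> set ks \<Longrightarrow> a i = b i) \<Longrightarrow> frob_form f a ks = frob_form f b ks"
proof (induction ks arbitrary: a b)
  case (Cons k ks)
  have "frob_form f (a(i := a k * a i)) ks = frob_form f (b(i := b k * b i)) ks"
    if "i \<in> set ks" for i
    using that Cons.prems by (intro Cons.IH) auto
  moreover have "frob_form f a ks = frob_form f b ks"
    using Cons.prems by (intro Cons.IH) auto
  ultimately show ?case using Cons.prems by simp
qed simp

lemma frob_form_upd_notin:
  "i \<notin> set ks \<Longrightarrow> frob_form f (a(i := x)) ks = frob_form f a ks"
  by (rule frob_form_cong) auto

text \<open>Injectivity ensures that updating \<open>a\<close> at \<open>h i\<close> is seen only at
  the index \<open>i\<close>. This serves both to pass to the indices \<open>1, ..., n + 1\<close>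
  and to replace a block \<open>B\<close> by \<open>k # B\<close>.\<close>

lemma frob_form_map:
  "inj_on h (set ks) \<Longrightarrow> frob_form f a (map h ks) = frob_form f (a \<circ> h) ks"
proof (induction ks arbitrary: a)
  case (Cons k ks)
  have inj: "inj_on h (set ks)" using Cons.prems by (auto simp: inj_on_def)
  have "(\<Sum>i\<in>set (map h ks). frob_form f (a(i := a (h k) * a i)) (map h ks)) =
        (\<Sum>i\<in>set ks. frob_form f (a(h i := a (h k) * a (h i))) (map h ks))"
    by (simp add: sum.reindex[OF inj])
  also have "\<dots> = (\<Sum>i\<in>set ks. frob_form f ((a \<circ> h)(i := a (h k) * a (h i))) ks)"
  proof (rule sum.cong)
    fix i assume i: "i \<in> set ks"
    have "frob_form f (a(h i := a (h k) * a (h i))) (map h ks) =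
          frob_form f (a(h i := a (h k) * a (h i)) \<circ> h) ks"
      by (rule Cons.IH[OF inj])
    also have "\<dots> = frob_form f ((a \<circ> h)(i := a (h k) * a (h i))) ks"
      using inj i by (intro frob_form_cong) (auto simp: inj_on_def)
    finally show "frob_form f (a(h i := a (h k) * a (h i))) (map h ks) = \<dots>" .
  qed simp
  finally show ?case
    unfolding list.map frob_form.simps Cons.IH[OF inj, of a] by (simp add: comp_apply[abs_def])
qed simp

text \<open>If \<open>j\<close> is the head, its value enters each term of the recursion once,
  either under \<open>f\<close> or as a factor in another argument, where the induction hypothesis
  applies. Otherwise the update at \<open>i = j\<close> multiplies \<open>u\<close> and
  \<open>v\<close> by \<open>a k\<close>, and any other update commutes with the one at
  \<open>j\<close>.\<close>

lemma frob_form_add: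
  assumes add: "\<And>x y. f (x + y) = f x + f y"
  shows "distinct ks \<Longrightarrow> j \<in> set ks \<Longrightarrow>
    frob_form f (a(j := u + v)) ks = frob_form f (a(j := u)) ks + frob_form f (a(j := v)) ks"
proof (induction ks arbitrary: a j u v)
  case (Cons k ks)
  show ?case
  proof (cases "j = k")
    case True
    have notin: "k \<notin> set ks" using Cons.prems by simp
    have swap: "frob_form f ((a(k := w))(i := w * a i)) ks = frob_form f (a(i := w * a i)) ks"
      if "i \<in> set ks" for i w
      using notin that by (intro frob_form_cong) auto
    have expand: "frob_form f (a(k := w)) (k # ks) =
        f w * frob_form f a ks - (\<Sum>i\<in>set ks. frob_form f (a(i := w * a i)) ks)" for w
    proof -
      have "(\<Sum>i\<in>set ks. frob_form f ((a(k := w))(i := (a(k := w)) k * (a(k := w)) i)) ks) =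
            (\<Sum>i\<in>set ks. frob_form f (a(i := w * a i)) ks)"
        using notin by (intro sum.cong refl, subst swap[symmetric]) auto
      then show ?thesis by (simp add: frob_form_upd_notin[OF notin])
    qed
    have "(\<Sum>i\<in>set ks. frob_form f (a(i := (u + v) * a i)) ks) =
        (\<Sum>i\<in>set ks. frob_form f (a(i := u * a i)) ks) + (\<Sum>i\<in>set ks. frob_form f (a(i := v * a i)) ks)"
      unfolding sum.distrib[symmetric] distrib_right
      by (intro sum.cong refl Cons.IH) (use Cons.prems in auto)
    then show ?thesis unfolding True expand by (simp add: add algebra_simps)
  next
    case False
    then have j: "j \<in> set ks" and dis: "distinct ks" using Cons.prems by auto
    have "frob_form f ((a(j := u + v))(i := a k * (a(j := u + v)) i)) ks =
        frob_form f ((a(j := u))(i := a k * (a(j := u)) i)) ks +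
        frob_form f ((a(j := v))(i := a k * (a(j := v)) i)) ks" for i
    proof (cases "i = j")
      case True
      then show ?thesis using Cons.IH[OF dis j, of a "a k * u" "a k * v"]
        by (simp only: fun_upd_upd fun_upd_same distrib_left)
    next
      case False
      then show ?thesis using Cons.IH[OF dis j, of "a(i := a k * a i)" u v]
        by (simp only: fun_upd_twist[OF False] fun_upd_other[OF False])
    qed
    then have sums: "(\<Sum>i\<in>set ks. frob_form f ((a(j := u + v))(i := a k * (a(j := u + v)) i)) ks) =
        (\<Sum>i\<in>set ks. frob_form f ((a(j := u))(i := a k * (a(j := u)) i)) ks) +
        (\<Sum>i\<in>set ks. frob_form f ((a(j := v))(i := a k * (a(j := v)) i)) ks)"
      by (simp add: sum.distrib)
    have "(a(j := w)) k = a k" for w using False by simp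
    then show ?thesis
      by (simp only: frob_form.simps sums Cons.IH[OF dis j, of a u v] distrib_left add_diff_add)
  qed
qed simp

lemma frob_form_zero:
  assumes "\<And>x y. f (x + y) = f x + f y" "distinct ks" "j \<in> set ks" "a j = 0"
  shows "frob_form f a ks = 0"
  using frob_form_add[OF assms(1-3), of a 0 0] assms(4) by (simp add: fun_upd_idem)

lemma frob_form_diff:
  assumes "\<And>x y. f (x + y) = f x + f y" "distinct ks" "j \<in> set ks"
  shows "frob_form f (a(j := u - v)) ks = frob_form f (a(j := u)) ks - frob_form f (a(j := v)) ks"
  using frob_form_add[OF assms, of a "u - v" v] by simp

lemma frob_form_sum:
  assumes "\<And>x y. f (x + y) = f x + f y" "distinct ks" "j \<in> set ks" "finite I"
  shows "frob_form f (a(j := sum u I)) ks = (\<Sum>i\<in>I. frob_form f (a(j := u i)) ks)"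
  using assms(4)
proof (induction I)
  case empty
  have "frob_form f (a(j := 0)) ks = 0" by (rule frob_form_zero[OF assms(1-3)]) simp
  then show ?case by (simp only: sum.empty)
next
  case (insert i I)
  then show ?case
    using frob_form_add[OF assms(1-3), of a "u i" "sum u I"] by (simp only: sum.insert[OF insert.hyps] insert.IH)
qed

text \<open>Every term of the recursion contains a form on the tail, so vanishing passes from one
  length to the next. The starting length \<open>n + 1\<close> is the hypothesis after
  reindexing.\<close>

lemma frob_form_vanish:
  assumes "\<And>a :: nat \<Rightarrow> _. frob_form f a [1..<Suc (Suc n)] = 0"
  shows "distinct ks \<Longrightarrow> n < length ks \<Longrightarrow> frob_form f a ks = 0"
proof (induction ks arbitrary: a)
  case (Cons k ks)
  show ?case
  proof (cases "n < length ks")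
    case True
    then show ?thesis using Cons by simp
  next
    case False
    \<comment> \<open>The hypothesis counts indices from 1, list positions count from 0.\<close>
    let ?h = "\<lambda>i. (k # ks) ! (i - 1)"
    have len: "length (k # ks) = Suc n" using False Cons.prems by simp
    have eq: "k # ks = map ?h [1..<Suc (Suc n)]"
      using len by (intro nth_equalityI) (auto simp del: upt_Suc)
    have "inj_on ?h (set [1..<Suc (Suc n)])"
      using Cons.prems(1) len eq by (metis distinct_map)
    then have "frob_form f a (map ?h [1..<Suc (Suc n)]) = 0"
      using assms by (simp add: frob_form_map del: upt_Suc)
    then show ?thesis using eq by simp
  qed
qed simp

section \<open>Combinatorics of set partitions\<close>

text \<open>
  Set partitions as lists of blocks. A new index is put at the head of its block and a new
  block at the head of the partition, where the recursion of \<open>frob_form\<close> unfolds.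
\<close>

fun set_parts :: "'i list \<Rightarrow> 'i list list list" where
  "set_parts [] = [[]]"
| "set_parts (k # ks) = concat (map (\<lambda>p. ([k] # p) #
     map (\<lambda>B. map (\<lambda>C. if C = B then k # C else C) p) p) (set_parts ks))"

lemma set_parts_Cons_cases:
  assumes "p \<in> set (set_parts (k # ks))"
  obtains q where "q \<in> set (set_parts ks)" "p = [k] # q"
  | q B where "q \<in> set (set_parts ks)" "B \<in> set q" "p = map (\<lambda>C. if C = B then k # C else C) q"
  using assms by auto

lemma set_parts_props:
  assumes "distinct ks" "p \<in> set (set_parts ks)"
  shows "[] \<notin> set p \<and> distinct p \<and> (\<forall>B\<in>set p. distinct B) \<and>
    (\<forall>B\<in>set p. \<forall>C\<in>set p. B \<noteq> C \<longrightarrow> set B \<inter> set C = {}) \<and> \<Union> (set ` set p) = set ks"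
  using assms
proof (induction ks arbitrary: p)
  case (Cons k ks)
  from Cons.prems(2) show ?case
  proof (cases rule: set_parts_Cons_cases)
    case (1 q)
    have k: "k \<notin> set ks" using Cons.prems by simp
    have IH: "[] \<notin> set q" "distinct q" "\<forall>B\<in>set q. distinct B"
      "\<forall>B\<in>set q. \<forall>C\<in>set q. B \<noteq> C \<longrightarrow> set B \<inter> set C = {}" "\<Union> (set ` set q) = set ks"
      using Cons.IH[OF _ 1(1)] Cons.prems by auto
    then have "\<forall>B\<in>set q. k \<notin> set B" using k by auto
    then show ?thesis using IH unfolding 1 by auto
  next
    case (2 q B)
    have k: "k \<notin> set ks" using Cons.prems by simp
    have IH: "[] \<notin> set q" "distinct q" "\<forall>B\<in>set q. distinct B"
      "\<forall>B\<in>set q. \<forall>C\<in>set q. B \<noteq> C \<longrightarrow> set B \<inter> set C = {}" "\<Union> (set ` set q) = set ks"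
      using Cons.IH[OF _ 2(1)] Cons.prems by auto
    then have kq: "\<forall>B\<in>set q. k \<notin> set B" using k by auto
    \<comment> \<open>The enlarged block is the only one containing \<open>k\<close>, so it cannot
      coincide with another block.\<close>
    have "inj_on (\<lambda>C. if C = B then k # C else C) (set q)"
      using kq by (auto simp: inj_on_def)
    then have "distinct p" using IH(2) unfolding 2 by (simp add: distinct_map)
    moreover have "\<Union> (set ` set p) = set (k # ks)"
    proof -
      have "\<Union> (set ` set p) = insert k (\<Union> (set ` set q))"
        using 2(2) unfolding 2(3) by (auto split: if_splits)
      then show ?thesis using IH(5) by simp
    qed
    moreover have "\<forall>D\<in>set p. \<forall>C\<in>set p. D \<noteq> C \<longrightarrow> set D \<inter> set C = {}"
      using IH(4) kq 2(2) unfolding 2(3) by auto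
    ultimately show ?thesis using IH(1,3) kq 2(2) unfolding 2(3) by auto
  qed
qed simp

lemma set_parts_length:
  assumes "distinct ks" "p \<in> set (set_parts ks)"
  shows "length ks = (\<Sum>B\<in>set p. length B)"
proof -
  have "length ks = card (\<Union> (set ` set p))"
    using set_parts_props[OF assms] distinct_card[OF assms(1)] by simp
  also have "\<dots> = (\<Sum>B\<in>set p. card (set B))"
    using set_parts_props[OF assms] by (intro card_UN_disjoint) auto
  also have "\<dots> = (\<Sum>B\<in>set p. length B)"
    using set_parts_props[OF assms] by (intro sum.cong) (auto simp: distinct_card)
  finally show ?thesis .
qed

text \<open>This brings the sum over partitions into the shape of the recursion of
  \<open>frob_form\<close>. The blocks of a partition are distinct, so the list of blocks may be
  summed as a set.\<close>

lemma sum_list_set_parts_Cons: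
  assumes "distinct (k # ks)"
  shows "(\<Sum>p\<leftarrow>set_parts (k # ks). h p) = (\<Sum>p\<leftarrow>set_parts ks. h ([k] # p) +
    (\<Sum>B\<in>set p. h (map (\<lambda>C. if C = B then k # C else C) p)))"
proof -
  have "(\<Sum>q\<leftarrow>concat (map (\<lambda>p. ([k] # p) # map (\<lambda>B. map (\<lambda>C. if C = B then k # C else C) p) p) ps). h q) =
    (\<Sum>p\<leftarrow>ps. h ([k] # p) + (\<Sum>B\<leftarrow>p. h (map (\<lambda>C. if C = B then k # C else C) p)))" for ps
    by (induction ps) (simp_all add: comp_def add.assoc)
  then have "(\<Sum>p\<leftarrow>set_parts (k # ks). h p) = (\<Sum>p\<leftarrow>set_parts ks. h ([k] # p) +
    (\<Sum>B\<leftarrow>p. h (map (\<lambda>C. if C = B then k # C else C) p)))"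
    by simp
  also have "\<dots> = (\<Sum>p\<leftarrow>set_parts ks. h ([k] # p) +
    (\<Sum>B\<in>set p. h (map (\<lambda>C. if C = B then k # C else C) p)))"
    using set_parts_props[of ks] assms
    by (intro arg_cong[of _ _ sum_list] map_cong refl arg_cong2[of _ _ _ _ "(+)"])
      (auto simp: sum_list_distinct_conv_sum_set)
  finally show ?thesis .
qed

lemma sum_sum_list: "(\<Sum>i\<in>I. \<Sum>x\<leftarrow>xs. h i x) = (\<Sum>x\<leftarrow>xs. \<Sum>i\<in>I. h i x)"
  by (induction xs) (simp_all add: sum.distrib)

section \<open>The form of a composite as a sum over set partitions\<close>

lemma frob_form_comp:
  assumes add: "\<And>x y. g (x + y) = g x + g y"
  shows "distinct ks \<Longrightarrow>
    frob_form (g \<circ> f) a ks = (\<Sum>p\<leftarrow>set_parts ks. frob_form g (frob_form f a) p)"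
proof (induction ks arbitrary: a)
  case (Cons k ks)
  let ?b = "frob_form f a"
  \<comment> \<open>An index \<open>i\<close> affects only its own block, so the sum over \<open>i\<close> splits over the blocks \<open>B\<close>. By
    additivity of \<open>g\<close> each part collapses to the argument \<open>f (a k) * ?b B - ?b (k # B)\<close> at \<open>B\<close>. The
    first term comes from expanding the partition with block \<open>[k]\<close>, the second is the partition
    with \<open>k\<close> added to \<open>B\<close>.\<close>
  have dis: "distinct ks" and k: "k \<notin> set ks" using Cons.prems by auto
  have step: "g (f (a k)) * frob_form g ?b p -
      (\<Sum>i\<in>set ks. frob_form g (frob_form f (a(i := a k * a i))) p) =
      frob_form g ?b ([k] # p) + (\<Sum>B\<in>set p. frob_form g ?b (map (\<lambda>C. if C = B then k # C else C) p))"
    if "p \<in> set (set_parts ks)" for p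
  proof -
    note props = set_parts_props[OF dis that]
    have disp: "distinct p" using props by simp
    have block: "(\<Sum>i\<in>set B. frob_form g (frob_form f (a(i := a k * a i))) p) =
        frob_form g (?b(B := f (a k) * ?b B)) p -
        frob_form g ?b (map (\<lambda>C. if C = B then k # C else C) p)" if B: "B \<in> set p" for B
    proof -
      have kB: "k \<notin> set C" if "C \<in> set p" for C using props k that by auto
      have "(\<Sum>i\<in>set B. frob_form g (frob_form f (a(i := a k * a i))) p) =
          (\<Sum>i\<in>set B. frob_form g (?b(B := frob_form f (a(i := a k * a i)) B)) p)"
      proof (intro sum.cong refl frob_form_cong)
        fix i C assume i: "i \<in> set B" and C: "C \<in> set p"
        show "frob_form f (a(i := a k * a i)) C = (?b(B := frob_form f (a(i := a k * a i)) B)) C"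
        proof (cases "C = B")
          case False
          then have "i \<notin> set C" using props i B C by blast
          then show ?thesis using False by (simp add: frob_form_upd_notin)
        qed simp
      qed
      also have "\<dots> = frob_form g (?b(B := (\<Sum>i\<in>set B. frob_form f (a(i := a k * a i)) B))) p"
        by (simp add: frob_form_sum[OF add disp B])
      also have "(\<Sum>i\<in>set B. frob_form f (a(i := a k * a i)) B) = f (a k) * ?b B - ?b (k # B)"
        by simp
      also have "frob_form g (?b(B := \<dots>)) p =
          frob_form g (?b(B := f (a k) * ?b B)) p - frob_form g (?b(B := ?b (k # B))) p"
        by (rule frob_form_diff[OF add disp B])
      \<comment> \<open>Giving \<open>B\<close> the value of \<open>k # B\<close> amounts to
        relabelling \<open>B\<close> as \<open>k # B\<close>. The relabelling is injective on
        \<open>p\<close> because no block of \<open>p\<close> contains \<open>k\<close>.\<close>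
      also have "frob_form g (?b(B := ?b (k # B))) p =
          frob_form g (?b \<circ> (\<lambda>C. if C = B then k # C else C)) p"
        by (rule frob_form_cong) auto
      also have "\<dots> = frob_form g ?b (map (\<lambda>C. if C = B then k # C else C) p)"
        by (rule frob_form_map[symmetric]) (use kB in \<open>force simp: inj_on_def\<close>)
      finally show ?thesis .
    qed
    have "(\<Sum>i\<in>set ks. frob_form g (frob_form f (a(i := a k * a i))) p) =
        (\<Sum>i\<in>(\<Union>B\<in>set p. set B). frob_form g (frob_form f (a(i := a k * a i))) p)"
      using props by simp
    also have "\<dots> = (\<Sum>B\<in>set p. \<Sum>i\<in>set B. frob_form g (frob_form f (a(i := a k * a i))) p)"
      using props by (intro sum.UNION_disjoint) auto
    also have "\<dots> = (\<Sum>B\<in>set p. frob_form g (?b(B := f (a k) * ?b B)) p) -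
        (\<Sum>B\<in>set p. frob_form g ?b (map (\<lambda>C. if C = B then k # C else C) p))"
      by (simp add: block sum_subtractf)
    finally show ?thesis by (simp add: algebra_simps)
  qed
  have "frob_form (g \<circ> f) a (k # ks) =
      g (f (a k)) * (\<Sum>p\<leftarrow>set_parts ks. frob_form g ?b p) -
      (\<Sum>i\<in>set ks. \<Sum>p\<leftarrow>set_parts ks. frob_form g (frob_form f (a(i := a k * a i))) p)"
    unfolding frob_form.simps Cons.IH[OF dis] by (simp only: comp_apply)
  also have "\<dots> = (\<Sum>p\<leftarrow>set_parts ks. g (f (a k)) * frob_form g ?b p -
      (\<Sum>i\<in>set ks. frob_form g (frob_form f (a(i := a k * a i))) p))"
    by (simp add: sum_list_subtractf sum_list_const_mult sum_sum_list)
  also have "\<dots> = (\<Sum>p\<leftarrow>set_parts (k # ks). frob_form g ?b p)"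
    unfolding sum_list_set_parts_Cons[OF Cons.prems]
    by (intro arg_cong[of _ _ sum_list] map_cong refl step)
  finally show ?case .
qed simp

lemma frob_form_comp_vanish:
  assumes f: "\<And>a :: nat \<Rightarrow> _. frob_form f a [1..<Suc (Suc n)] = 0"
    and g: "\<And>a :: nat \<Rightarrow> _. frob_form g a [1..<Suc (Suc m)] = 0"
    and add: "\<And>x y. g (x + y) = g x + g y"
    and ks: "distinct ks" "length ks = Suc (m * n)"
  shows "frob_form (g \<circ> f) a ks = 0"
proof -
  have "frob_form g (frob_form f a) p = 0" if p: "p \<in> set (set_parts ks)" for p
  proof (cases "m < length p")
    case True
    then show ?thesis using frob_form_vanish[of g, OF g] set_parts_props[OF ks(1) p] by auto
  next
    case False
    \<comment> \<open>Pigeonhole: at most \<open>m\<close> blocks of at most \<open>n\<close>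
      indices cover at most \<open>m * n\<close> indices, one too few.\<close>
    have "\<exists>B\<in>set p. n < length B"
    proof (rule ccontr)
      assume "\<not> (\<exists>B\<in>set p. n < length B)"
      then have "(\<Sum>B\<in>set p. length B) \<le> card (set p) * n"
        by (intro sum_bounded_above[of _ length n, simplified]) auto
      also have "\<dots> \<le> m * n" using False card_length[of p] by (intro mult_right_mono) auto
      finally show False using set_parts_length[OF ks(1) p] ks(2) by simp
    qed
    then obtain B where "B \<in> set p" "n < length B" by blast
    then show ?thesis
      using frob_form_zero[OF add, of p B] frob_form_vanish[of f, OF f] set_parts_props[OF ks(1) p]
      by blast
  qed
  then show ?thesis unfolding frob_form_comp[OF add ks(1)] by (simp cong: map_cong)
qed

section \<open>Cycles of a permutation after inserting a point\<close>

text \<open>Composing with \<open>transpose x b\<close> splices \<open>x\<close> into the cycle of \<open>p\<close> through \<open>b\<close>.\<close>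

lemma orbit_transpose_comp:
  assumes fin: "finite S" and x: "x \<notin> S" and p: "p permutes S" and b: "b \<in> S"
  defines "q \<equiv> transpose x b \<circ> p"
  shows orbit_transpose_comp_new: "orbit q x = insert x (orbit p b)"
    and orbit_transpose_comp_split: "y \<in> S \<Longrightarrow>
      orbit q y = (if b \<in> orbit p y then insert x (orbit p y) else orbit p y)"
proof -
  have px: "p x = x" using p x by (simp add: permutes_not_in)
  have perm: "permutation p" using permutation_permutes fin p by blast
  have q: "q permutes insert x S" unfolding q_def
    using p b by (intro permutes_compose permutes_swap_id) (auto intro: permutes_subset)
  have permq: "permutation q" using permutation_permutes fin q by blast
  have qx: "q x = b" by (simp add: q_def px)
  \<comment> \<open>\<open>orbit\<close> starts at the image of a point; the point itself belongs to
    it because a permutation of a finite set eventually returns.\<close>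
  have self: "z \<in> orbit q z" "z \<in> orbit p z" for z
    by (simp_all add: permutation_self_in_orbit permq perm)
  \<comment> \<open>On \<open>S\<close>, \<open>q\<close> follows \<open>p\<close>, except that the
    arrow into \<open>b\<close> is redirected to \<open>x\<close>, from which \<open>q\<close>
    continues to \<open>b\<close>.\<close>
  have qz: "q z = (if p z = b then x else p z)" if "z \<in> S" for z
    using that x permutes_in_image[OF p, of z] by (auto simp: q_def transpose_def)
  have sub: "orbit p y \<subseteq> S" if "y \<in> S" for y
    using that p by (simp add: permutes_orbit_subset)
  have bx: "orbit q x = orbit q b"
    using self[of x] permutation_orbit_step[OF permq, of x] qx by simp
  have old_b: "orbit p b \<subseteq> orbit q b"
  proof
    fix z assume "z \<in> orbit p b"
    then show "z \<in> orbit q b"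
    proof induction
      case base
      then show ?case using qz[OF b] self(1)[of b] orbit.base[of q b] by (auto split: if_splits)
    next
      case (step y)
      then have "y \<in> S" using sub[OF b] by blast
      then show ?case using qz[of y] self(1)[of b] orbit.step[OF step.IH] by (auto split: if_splits)
    qed
  qed
  have "orbit q b \<subseteq> insert x (orbit p b)"
  proof
    fix z assume "z \<in> orbit q b"
    then show "z \<in> insert x (orbit p b)"
    proof induction
      case base
      then show ?case using qz[OF b] by (auto intro: orbit.intros)
    next
      case (step y)
      then consider "y = x" | "y \<in> orbit p b" "y \<in> S" using sub[OF b] by blast
      then show ?case
        by cases (use qz[of y] qx self(2)[of b] in \<open>auto intro: orbit.step\<close>)
    qed
  qed
  moreover have "x \<in> orbit q b" using self(1)[of x] bx by simp
  ultimately show new: "orbit q x = insert x (orbit p b)" using old_b bx by auto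
  assume y: "y \<in> S"
  show "orbit q y = (if b \<in> orbit p y then insert x (orbit p y) else orbit p y)"
  proof (cases "b \<in> orbit p y")
    case True
    then have eq: "orbit p y = orbit p b"
      using self by (metis orbit_trans orbit_swap subset_antisym subsetI)
    then have "y \<in> orbit q b" using self(2)[of y] old_b by blast
    then have "orbit q y = orbit q b"
      using self by (metis orbit_trans orbit_swap subset_antisym subsetI)
    then show ?thesis using True new bx eq by simp
  next
    case False
    \<comment> \<open>The redirected arrow ends in \<open>b\<close>, so it lies outside this cycle
      and both maps agree along it.\<close>
    have "orbit q y = orbit p y"
    proof (rule orbit_cong0[symmetric])
      show "y \<in> orbit p y" by (rule self)
      show "p \<in> orbit p y \<rightarrow> orbit p y" by (auto intro: orbit.intros)
      fix z assume z: "z \<in> orbit p y"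
      then have "z \<in> S" using sub[OF y] by blast
      moreover have "p z \<noteq> b" using False z orbit.step by metis
      ultimately show "p z = q z" using qz by simp
    qed
    then show ?thesis using False by simp
  qed
qed

section \<open>The signed permutation sum satisfies the same recursion\<close>

text \<open>This is \<open>Phi\<close> on an arbitrary index set instead of \<open>{1..n}\<close>,
  so that an induction can insert one index at a time.\<close>

definition perm_sum :: "(complex \<Rightarrow> 'b \<Rightarrow> 'b) \<Rightarrow> ('a::{comm_ring,comm_monoid_mult} \<Rightarrow> 'b::{comm_ring,comm_monoid_mult})
     \<Rightarrow> (nat \<Rightarrow> 'a) \<Rightarrow> nat set \<Rightarrow> 'b" where
  "perm_sum sB f a S = (\<Sum>p | p permutes S.
     sB (of_int (sign p)) (\<Prod>\<gamma>\<in>orbit p ` S. cycle_val f \<gamma> a))"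

lemma cycle_prod_fixpoint:
  assumes fin: "finite S" and x: "x \<notin> S" and p: "p permutes S"
  shows "(\<Prod>\<gamma>\<in>orbit p ` insert x S. cycle_val f \<gamma> a) =
    f (a x) * (\<Prod>\<gamma>\<in>orbit p ` S. cycle_val f \<gamma> a)"
proof -
  have "orbit p x = {x}" using p x by (simp add: orbit_eq_singleton_iff permutes_not_in)
  moreover have "{x} \<notin> orbit p ` S" using x permutes_orbit_subset[OF p] by blast
  ultimately show ?thesis using fin by (simp add: cycle_val_def)
qed

text \<open>Splicing \<open>x\<close> into the cycle through \<open>b\<close> multiplies the product
  along that cycle by \<open>a x\<close>, as if \<open>a b\<close> were replaced by
  \<open>a x * a b\<close>.\<close>

lemma cycle_prod_transpose:
  assumes fin: "finite S" and x: "x \<notin> S" and p: "p permutes S" and b: "b \<in> S"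
  shows "(\<Prod>\<gamma>\<in>orbit (transpose x b \<circ> p) ` insert x S. cycle_val f \<gamma> a) =
    (\<Prod>\<gamma>\<in>orbit p ` S. cycle_val f \<gamma> (a(b := a x * a b)))"
proof -
  \<comment> \<open>\<open>h\<close> matches the old cycles with the new ones; it is injective
    because no old cycle contains \<open>x\<close>.\<close>
  define h where "h \<gamma> = (if b \<in> \<gamma> then insert x \<gamma> else \<gamma>)" for \<gamma>
  note orb = orbit_transpose_comp[OF fin x p b]
  have sub: "orbit p y \<subseteq> S" if "y \<in> S" for y
    using that p by (simp add: permutes_orbit_subset)
  have "permutation p" using permutation_permutes fin p by blast
  then have bb: "b \<in> orbit p b" by (rule permutation_self_in_orbit)
  have "orbit (transpose x b \<circ> p) x = h (orbit p b)" using orb(1) bb by (simp add: h_def)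
  moreover have "orbit (transpose x b \<circ> p) y = h (orbit p y)" if "y \<in> S" for y
    using orb(2)[OF that] by (simp add: h_def)
  ultimately have "orbit (transpose x b \<circ> p) ` insert x S = h ` orbit p ` S"
    using b by (auto simp: image_image)
  moreover have "inj_on h (orbit p ` S)"
  proof (rule inj_onI)
    fix \<gamma> \<delta> assume "\<gamma> \<in> orbit p ` S" "\<delta> \<in> orbit p ` S" "h \<gamma> = h \<delta>"
    moreover from this have "x \<notin> \<gamma>" "x \<notin> \<delta>" using sub x by blast+
    ultimately show "\<gamma> = \<delta>" unfolding h_def by (auto split: if_splits)
  qed
  moreover have "cycle_val f (h \<gamma>) a = cycle_val f \<gamma> (a(b := a x * a b))"
    if "\<gamma> \<in> orbit p ` S" for \<gamma>
  proof -
    have "\<gamma> \<subseteq> S" using that sub by blast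
    then have g: "finite \<gamma>" "x \<notin> \<gamma>" using fin x finite_subset by auto
    show ?thesis
    proof (cases "b \<in> \<gamma>")
      case True
      have "(\<Prod>i\<in>\<gamma> - {b}. (a(b := a x * a b)) i) = (\<Prod>i\<in>\<gamma> - {b}. a i)"
        by (rule prod.cong) auto
      then show ?thesis
        using True g by (simp add: h_def cycle_val_def prod.remove[OF g(1) True] mult.assoc)
    next
      case False
      then have "(\<Prod>i\<in>\<gamma>. (a(b := a x * a b)) i) = (\<Prod>i\<in>\<gamma>. a i)"
        by (intro prod.cong) auto
      then show ?thesis using False by (simp add: h_def cycle_val_def)
    qed
  qed
  ultimately show ?thesis by (simp add: prod.reindex)
qed

context comm_complex_algebra
begin

text \<open>A permutation of \<open>insert x S\<close> is uniquely
  \<open>transpose x b \<circ> p\<close> with \<open>p\<close> permuting \<open>S\<close> and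
  \<open>b\<close> in \<open>insert x S\<close>. The choice \<open>b = x\<close> makes
  \<open>x\<close> a fixed point and yields the factor \<open>f (a x)\<close>; any other
  \<open>b\<close> splices \<open>x\<close> into a cycle and flips the sign.\<close>

lemma perm_sum_insert:
  assumes fin: "finite S" and x: "x \<notin> S"
  shows "perm_sum scale f a (insert x S) =
    f (a x) * perm_sum scale f a S - (\<Sum>b\<in>S. perm_sum scale f (a(b := a x * a b)) S)"
proof -
  let ?P = "\<lambda>p S a. \<Prod>\<gamma>\<in>orbit p ` S. cycle_val f \<gamma> a"
  have neg: "scale (of_int (sign (transpose x b \<circ> p))) (?P (transpose x b \<circ> p) (insert x S) a) =
      - scale (of_int (sign p)) (?P p S (a(b := a x * a b)))"
    if "p permutes S" "b \<in> S" for p b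
  proof -
    have "permutation p" using permutation_permutes fin that(1) by blast
    moreover have "x \<noteq> b" using x that by blast
    ultimately have "sign (transpose x b \<circ> p) = - sign p"
      by (simp add: sign_compose permutation_swap_id sign_swap_id)
    then show ?thesis by (simp only: cycle_prod_transpose[OF fin x that] of_int_minus scale_minus_left)
  qed
  have fixpoint: "scale (of_int (sign p)) (?P p (insert x S) a) =
      f (a x) * scale (of_int (sign p)) (?P p S a)" if "p permutes S" for p
    unfolding cycle_prod_fixpoint[OF fin x that]
    by (metis scale_mult_left mult.commute)
  have "perm_sum scale f a (insert x S) = (\<Sum>b\<in>insert x S. \<Sum>p | p permutes S.
      scale (of_int (sign (transpose x b \<circ> p))) (?P (transpose x b \<circ> p) (insert x S) a))"
    unfolding perm_sum_def by (rule sum_over_permutations_insert[OF fin x])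
  also have "\<dots> = (\<Sum>p | p permutes S. f (a x) * scale (of_int (sign p)) (?P p S a)) +
      (\<Sum>b\<in>S. \<Sum>p | p permutes S. - scale (of_int (sign p)) (?P p S (a(b := a x * a b))))"
    using fin x neg fixpoint by (simp add: sum.insert del: image_insert)
  finally show ?thesis
    by (simp add: perm_sum_def sum_distrib_left sum_negf)
qed

lemma perm_sum_eq_frob_form:
  "distinct ks \<Longrightarrow> perm_sum scale f a (set ks) = frob_form f a ks"
proof (induction ks arbitrary: a)
  case Nil
  then show ?case by (simp add: perm_sum_def sign_id)
next
  case (Cons k ks)
  then show ?case by (simp add: perm_sum_insert)
qed

lemma Phi_eq_frob_form: "Phi scale n f a = frob_form f a [1..<Suc n]"
  using perm_sum_eq_frob_form[of "[1..<Suc n]" f a]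
  by (simp add: perm_sum_def Phi_def perm_cycles_def atLeastLessThanSuc_atLeastAtMost del: upt_Suc)

end

section \<open>Composition of Frobenius homomorphisms\<close>

theorem theorem2p1:
  fixes sA :: "complex \<Rightarrow> 'a::{comm_ring,comm_monoid_mult} \<Rightarrow> 'a"
    and sB :: "complex \<Rightarrow> 'b::{comm_ring,comm_monoid_mult} \<Rightarrow> 'b"
    and sC :: "complex \<Rightarrow> 'c::{comm_ring,comm_monoid_mult} \<Rightarrow> 'c"
    and f :: "'a \<Rightarrow> 'b" and g :: "'b \<Rightarrow> 'c" and n m :: nat
  assumes "comm_complex_algebra sA" and "comm_complex_algebra sB" and "comm_complex_algebra sC"
    and "frobenius_hom sA sB n f" and "frobenius_hom sB sC m g"
  shows "frobenius_hom sA sC (m * n) (g \<circ> f)"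
proof -
  interpret B: comm_complex_algebra sB by fact
  interpret C: comm_complex_algebra sC by fact
  have lf: "Vector_Spaces.linear sA sB f" and f1: "f 1 = sB (of_nat n) 1"
    and f: "\<And>a. frob_form f a [1..<Suc (Suc n)] = 0"
    using assms(4) by (auto simp: frobenius_hom_def B.Phi_eq_frob_form simp del: upt_Suc)
  have lg: "Vector_Spaces.linear sB sC g" and g1: "g 1 = sC (of_nat m) 1"
    and g: "\<And>a. frob_form g a [1..<Suc (Suc m)] = 0"
    using assms(5) by (auto simp: frobenius_hom_def C.Phi_eq_frob_form simp del: upt_Suc)
  interpret g: Vector_Spaces.linear sB sC g by (rule lg)
  have "Vector_Spaces.linear sA sC (g \<circ> f)"
    using lf lg by (rule Vector_Spaces.linear_compose)
  moreover have "(g \<circ> f) 1 = sC (of_nat (m * n)) 1"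
    by (simp add: f1 g.scale g1 mult.commute)
  moreover have "Phi sC (m * n + 1) (g \<circ> f) a = 0" for a
    using frob_form_comp_vanish[of f n g m, OF f g g.add, of "[1..<Suc (Suc (m * n))]" a]
    by (simp add: C.Phi_eq_frob_form del: upt_Suc)
  ultimately show ?thesis by (simp add: frobenius_hom_def)
qed

end
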